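(* Let $B$ be a bigraph under a signature $\Sigma=(K,arity)$. Then $\big[\!\big[\,[\![B]\!]\,\big]\!\big]^{\star}\bumpeq B$.
   Context: **Bigraphs.** A signature is $\Sigma=(K,arity)$ with $K$ a set of controls and $arity:K\to\mathbb N$. A bigraph under $\Sigma$ is $B=(V_B,E_B,P_B,ctrl_B,prnt_B,link_B):\langle m,X\rangle\to\langle n,Y\rangle$, where $m,n$ are finite ordinals (the sites, resp. roots), $X,Y,V_B,E_B$ are finite sets (inner names, outer names, nodes, edges), $ctrl_B:V_B\to K$, $P_B=\{(v,i)\mid v\in V_B,\ i\in arity(ctrl_B\,v)\}$ (ports; a natural number is the set of smaller numbers), $prnt_B:V_B\cup m\to V_B\cup n$ is total and establishes a tree-shaped (acyclic) parent ordering on the nodes, and $link_B:X\cup P_B\to E_B\cup Y$ is total. The sets $m,n,X,Y,V_B,E_B$ are assumed disjoint. **Lean equivalence.** Two bigraphs $B,G$ with the same interfaces $\langle k,X\rangle\to\langle m,Y\rangle$ satisfy $B\bumpeq G$ if there are bijections $\rho_V:V_B\to V_G$ and $\rho_E:E_B\to E_G$ with $ctrl_G\circ\rho_V=ctrl_B$ (so that $\rho_P:P_B\to P_G$, $\rho_P(v,i)=(\rho_V\,v,i)$, is a bijection), $prnt_G\circ(Id_k\uplus\rho_V)=(Id_m\uplus\rho_V)\circ prnt_B$ and $link_G\circ(Id_X\uplus\rho_P)=(Id_Y\uplus\rho_E)\circ link_B$. **Relation symbols.** Facts are built from names of the disjoint sorts node, root, site, port, o_name, i_name, e_name, and from controls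 and natural numbers. Destinations in the place graph are dst_n $a$ ($a$ a node), dst_r $r$ ($r$ a root); sources are src_n $a$, src_s $s$ ($s$ a site). In the link graph destinations are dst_o $o$ ($o$ an outer name), dst_e $e$ ($e$ an edge), sources are src_i $i$ ($i$ an inner name), src_p $p$ ($p$ a port). The facts are is_root $r$, is_node $a$, is_site $s$, is_port $p$, is_o_name $o$, is_i_name $i$, is_e_name $e$, prnt $S\,D$, link $S\,D$ ($S$ a source, $D$ a destination), lc $a\,k$ (node $a$ has control $k$), lp $p\,a$ (port $p$ belongs to node $a$), has_child_p $D\,N$, has_child_l $D\,N$ ($N$ a natural number). **Encoding.** Names are chosen injectively for the nodes, edges, ports, roots, sites, inner and outer names of $B$ (the names of different sorts being distinct); an element and its name are written alike, and for a name $t$ the element it stands for is written $|t|$. $[\![B]\!]$ is the multi-set in which each of the following occurs exactly once: is_root $r$, has_child_p (dst_r $r$) $|prnt_B^{-1}(r)|$ for each root $r\in n$; is_node $v$, lc $v$ $(ctrl_B\,v)$, has_child_p (dst_n $v$) $|prnt_B^{-1}(v)|$, prnt (src_n $v$) $(prnt_B\,v)$ for each $v\in V_B$; is_site $s$, prnt (src_s $s$) $(prnt_B\,s)$ for each site $s\in m$; is_port $p$, lp $p\,v$, link (src_p $p$) $(link_B\,p)$ for each port $p=(v,i)\in P_B$; is_o_name $o$, has_child_l (dst_o $o$) $|link_B^{-1}(o)|$ for each $o\in Y$; is_e_name $e$, has_child_l (dst_e $e$) $|link_B^{-1}(e)|$ for each $e\in E_B$; is_i_name $x$, link (src_i $x$)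 $(link_B\,x)$ for each $x\in X$. Here values of $prnt_B$ and $link_B$ carry the appropriate constructor dst_n, dst_r, dst_o, dst_e. **Interpretation.** For a multi-set $S$ that encodes a bigraph, $[\![S]\!]^\star$ is the bigraph read off from $S$: its nodes, edges, ports, roots, sites, outer names and inner names are the (elements denoted by the) names $t$ with, respectively, is_node $t$, is_e_name $t$, is_port $t$, is_root $t$, is_site $t$, is_o_name $t$, is_i_name $t$ in $S$; ports $p$ with lp $p\,v\in S$ are the ports of $v$; and $ctrl\,v=k$ iff lc $v\,k\in S$, $prnt\,x=y$ iff prnt $x\,y\in S$, $link\,x=y$ iff link $x\,y\in S$ (constructors src, dst dropped). *)

theory Defs
  imports Main "HOL-Library.Multiset" "HOL-Library.FuncSet"
begin

section \<open>Bigraphs\<close>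

record 'k signature =
  controls :: "'k set"
  arity :: "'k \<Rightarrow> nat"

text \<open>
  Nodes, edges and names live in separate types, and the unions of the domains and codomains of the
  parent and link maps are tagged (type \<open>+\<close>). So all disjointness assumptions on the sites, roots,
  names, nodes and edges hold by construction, except for the one between inner and outer names.
  A finite ordinal \<open>m\<close> is the set \<open>{..<m}\<close>. The maps are only meaningful on their domains.
\<close>

record ('k, 'v, 'e, 'x) bigraph =
  sites :: nat
  inner :: "'x set"
  roots :: nat
  outer :: "'x set"
  nodes :: "'v set"
  edges :: "'e set"
  ports :: "('v \<times> nat) set"
  ctrl :: "'v \<Rightarrow> 'k"
  prnt :: "'v + nat \<Rightarrow> 'v + nat"
  link :: "'x + 'v \<times> nat \<Rightarrow> 'e + 'x"

definition prnt_dom :: "('k, 'v, 'e, 'x) bigraph \<Rightarrow> ('v + nat) set" where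
  "prnt_dom B = nodes B <+> {..<sites B}"

definition link_dom :: "('k, 'v, 'e, 'x) bigraph \<Rightarrow> ('x + 'v \<times> nat) set" where
  "link_dom B = inner B <+> ports B"

definition is_bigraph :: "'k signature \<Rightarrow> ('k, 'v, 'e, 'x) bigraph \<Rightarrow> bool" where
  "is_bigraph \<Sigma> B \<longleftrightarrow>
     finite (inner B) \<and> finite (outer B) \<and> finite (nodes B) \<and> finite (edges B) \<and>
     inner B \<inter> outer B = {} \<and>
     ctrl B \<in> nodes B \<rightarrow> controls \<Sigma> \<and>
     ports B = (SIGMA v : nodes B. {..<arity \<Sigma> (ctrl B v)}) \<and>
     prnt B \<in> prnt_dom B \<rightarrow> nodes B <+> {..<roots B} \<and>
     acyclic {(v, w). v \<in> nodes B \<and> prnt B (Inl v) = Inl w} \<and>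
     link B \<in> link_dom B \<rightarrow> edges B <+> outer B"

definition lean_equiv ::
    "'k signature \<Rightarrow> ('k, 'v, 'e, 'x) bigraph \<Rightarrow> ('k, 'w, 'f, 'x) bigraph \<Rightarrow> bool" where
  "lean_equiv \<Sigma> B G \<longleftrightarrow>
     is_bigraph \<Sigma> B \<and> is_bigraph \<Sigma> G \<and>
     sites B = sites G \<and> inner B = inner G \<and> roots B = roots G \<and> outer B = outer G \<and>
     (\<exists>\<rho>V \<rho>E. bij_betw \<rho>V (nodes B) (nodes G) \<and> bij_betw \<rho>E (edges B) (edges G) \<and>
        (\<forall>v \<in> nodes B. ctrl G (\<rho>V v) = ctrl B v) \<and>
        (\<forall>x \<in> prnt_dom B. prnt G (map_sum \<rho>V id x) = map_sum \<rho>V id (prnt B x)) \<and>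
        (\<forall>x \<in> link_dom B.
           link G (map_sum id (map_prod \<rho>V id) x) = map_sum \<rho>E id (link B x)))"


section \<open>Facts over names\<close>

datatype 't dst_p = Dst_n (dst_p_name: 't) | Dst_r (dst_p_name: 't)
datatype 't src_p = Src_n (src_p_name: 't) | Src_s (src_p_name: 't)
datatype 't dst_l = Dst_o (dst_l_name: 't) | Dst_e (dst_l_name: 't)
datatype 't src_l = Src_i (src_l_name: 't) | Src_p (src_l_name: 't)

datatype ('t, 'k) fact =
    Is_root 't | Is_node 't | Is_site 't | Is_port 't | Is_o_name 't | Is_i_name 't | Is_e_name 't
  | Prnt "'t src_p" "'t dst_p"
  | Link "'t src_l" "'t dst_l"
  | Lc 't 'k
  | Lp 't 't
  | Has_child_p "'t dst_p" nat
  | Has_child_l "'t dst_l" nat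


section \<open>Names of the elements of a bigraph\<close>

datatype ('v, 'e, 'x) elem =
  Node 'v | Edge 'e | Port "'v \<times> nat" | Root nat | Site nat | O_name 'x | I_name 'x

definition elements :: "('k, 'v, 'e, 'x) bigraph \<Rightarrow> ('v, 'e, 'x) elem set" where
  "elements B = Node ` nodes B \<union> Edge ` edges B \<union> Port ` ports B \<union>
     Root ` {..<roots B} \<union> Site ` {..<sites B} \<union> O_name ` outer B \<union> I_name ` inner B"

text \<open>
  \<open>nm x\<close> is the name of \<open>x\<close> and \<open>den t\<close> the element that the name \<open>t\<close> stands for. All names share one
  type; since \<open>elem\<close> is a disjoint sum, injectivity on \<open>elements B\<close> also says that names of different
  sorts are distinct.
\<close>

definition naming ::
    "('k, 'v, 'e, 'x) bigraph \<Rightarrow> (('v, 'e, 'x) elem \<Rightarrow> 't) \<Rightarrow> ('t \<Rightarrow> ('v, 'e, 'x) elem) \<Rightarrow> bool" where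
  "naming B nm den \<longleftrightarrow> inj_on nm (elements B) \<and> (\<forall>x \<in> elements B. den (nm x) = x)"


section \<open>Encoding\<close>

fun place_dst :: "(('v, 'e, 'x) elem \<Rightarrow> 't) \<Rightarrow> 'v + nat \<Rightarrow> 't dst_p" where
  "place_dst nm (Inl v) = Dst_n (nm (Node v))"
| "place_dst nm (Inr r) = Dst_r (nm (Root r))"

fun link_dst :: "(('v, 'e, 'x) elem \<Rightarrow> 't) \<Rightarrow> 'e + 'x \<Rightarrow> 't dst_l" where
  "link_dst nm (Inl e) = Dst_e (nm (Edge e))"
| "link_dst nm (Inr y) = Dst_o (nm (O_name y))"

definition prnt_count :: "('k, 'v, 'e, 'x) bigraph \<Rightarrow> 'v + nat \<Rightarrow> nat" where
  "prnt_count B y = card {x \<in> prnt_dom B. prnt B x = y}"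

definition link_count :: "('k, 'v, 'e, 'x) bigraph \<Rightarrow> 'e + 'x \<Rightarrow> nat" where
  "link_count B y = card {x \<in> link_dom B. link B x = y}"

definition encode_set ::
    "(('v, 'e, 'x) elem \<Rightarrow> 't) \<Rightarrow> ('k, 'v, 'e, 'x) bigraph \<Rightarrow> ('t, 'k) fact set" where
  "encode_set nm B =
     (\<Union>r \<in> {..<roots B}.
        {Is_root (nm (Root r)),
         Has_child_p (Dst_r (nm (Root r))) (prnt_count B (Inr r))}) \<union>
     (\<Union>v \<in> nodes B.
        {Is_node (nm (Node v)),
         Lc (nm (Node v)) (ctrl B v),
         Has_child_p (Dst_n (nm (Node v))) (prnt_count B (Inl v)),
         Prnt (Src_n (nm (Node v))) (place_dst nm (prnt B (Inl v)))}) \<union>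
     (\<Union>s \<in> {..<sites B}.
        {Is_site (nm (Site s)),
         Prnt (Src_s (nm (Site s))) (place_dst nm (prnt B (Inr s)))}) \<union>
     (\<Union>p \<in> ports B.
        {Is_port (nm (Port p)),
         Lp (nm (Port p)) (nm (Node (fst p))),
         Link (Src_p (nm (Port p))) (link_dst nm (link B (Inr p)))}) \<union>
     (\<Union>y \<in> outer B.
        {Is_o_name (nm (O_name y)),
         Has_child_l (Dst_o (nm (O_name y))) (link_count B (Inr y))}) \<union>
     (\<Union>e \<in> edges B.
        {Is_e_name (nm (Edge e)),
         Has_child_l (Dst_e (nm (Edge e))) (link_count B (Inl e))}) \<union>
     (\<Union>x \<in> inner B.
        {Is_i_name (nm (I_name x)),
         Link (Src_i (nm (I_name x))) (link_dst nm (link B (Inl x)))})"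

text \<open>
  \<open>mset_set\<close> gives every fact multiplicity one; the set of facts is finite for every bigraph.
\<close>

definition encode ::
    "(('v, 'e, 'x) elem \<Rightarrow> 't) \<Rightarrow> ('k, 'v, 'e, 'x) bigraph \<Rightarrow> ('t, 'k) fact multiset" where
  "encode nm B = mset_set (encode_set nm B)"


section \<open>Interpretation\<close>

text \<open>
  Sites and roots form finite ordinals, so the interface only records how many of them \<open>S\<close> declares.
  The index \<open>i\<close> of a port \<open>(v, i)\<close> is not recorded in any fact: it comes from the element that the
  port's name stands for, while \<open>Lp\<close> makes it a port of \<open>v\<close>.
\<close>

definition interp ::
    "('t \<Rightarrow> ('v, 'e, 'x) elem) \<Rightarrow> ('t, 'k) fact multiset \<Rightarrow> ('k, 'v, 'e, 'x) bigraph" where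
  "interp den S = \<lparr>
     sites = card {s. \<exists>t. Is_site t \<in># S \<and> den t = Site s},
     inner = {x. \<exists>t. Is_i_name t \<in># S \<and> den t = I_name x},
     roots = card {r. \<exists>t. Is_root t \<in># S \<and> den t = Root r},
     outer = {y. \<exists>t. Is_o_name t \<in># S \<and> den t = O_name y},
     nodes = {v. \<exists>t. Is_node t \<in># S \<and> den t = Node v},
     edges = {e. \<exists>t. Is_e_name t \<in># S \<and> den t = Edge e},
     ports = {(v, i). \<exists>t a. Is_port t \<in># S \<and> Lp t a \<in># S \<and> den a = Node v \<and> den t = Port (v, i)},
     ctrl = (\<lambda>v. THE k. \<exists>a. Lc a k \<in># S \<and> den a = Node v),
     prnt = (\<lambda>x. THE y. \<exists>s d. Prnt s d \<in># S \<and>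
       den (src_p_name s) = case_sum Node Site x \<and> den (dst_p_name d) = case_sum Node Root y),
     link = (\<lambda>x. THE y. \<exists>s d. Link s d \<in># S \<and>
       den (src_l_name s) = case_sum I_name Port x \<and> den (dst_l_name d) = case_sum Edge O_name y)\<rparr>"

end

(* Every fact of the encoding names elements of B only, so den inverts nm on it. Hence the
   interpretation returns B itself, up to the junk values of its maps outside their domains, and
   the identity maps on nodes and edges witness the equivalence. *)
theory Submission imports Defs begin

text \<open>The encoding lists the facts of nodes and of sites in separate blocks. A single source
  map on the sum type lets all \<open>Prnt\<close> facts be treated as one family, matching
  \<open>place_dst\<close>.\<close>

fun place_src :: "(('v, 'e, 'x) elem \<Rightarrow> 't) \<Rightarrow> 'v + nat \<Rightarrow> 't src_p" where
  "place_src nm (Inl v) = Src_n (nm (Node v))"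
| "place_src nm (Inr s) = Src_s (nm (Site s))"

fun link_src :: "(('v, 'e, 'x) elem \<Rightarrow> 't) \<Rightarrow> 'x + 'v \<times> nat \<Rightarrow> 't src_l" where
  "link_src nm (Inl x) = Src_i (nm (I_name x))"
| "link_src nm (Inr p) = Src_p (nm (Port p))"

text \<open>\<open>mset_set\<close> sends an infinite set to the empty multiset, so finiteness is
  what lets membership in \<open>encode nm B\<close> be read off from
  \<open>encode_set nm B\<close>.\<close>

lemma finite_encode_set:
  assumes "is_bigraph \<Sigma> B"
  shows "finite (encode_set nm B)"
proof -
  have "finite (ports B)"
    using assms by (auto simp: is_bigraph_def)
  then show ?thesis
    using assms unfolding encode_set_def is_bigraph_def by simp
qed

lemma in_encode_iff:
  assumes "is_bigraph \<Sigma> B"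
  shows "f \<in># encode nm B \<longleftrightarrow> f \<in> encode_set nm B"
  by (simp add: encode_def finite_encode_set[OF assms])

lemma encode_set_simps:
  "Is_root t \<in> encode_set nm B \<longleftrightarrow> (\<exists>r<roots B. t = nm (Root r))"
  "Is_node t \<in> encode_set nm B \<longleftrightarrow> (\<exists>v\<in>nodes B. t = nm (Node v))"
  "Is_site t \<in> encode_set nm B \<longleftrightarrow> (\<exists>s<sites B. t = nm (Site s))"
  "Is_port t \<in> encode_set nm B \<longleftrightarrow> (\<exists>p\<in>ports B. t = nm (Port p))"
  "Is_o_name t \<in> encode_set nm B \<longleftrightarrow> (\<exists>y\<in>outer B. t = nm (O_name y))"
  "Is_i_name t \<in> encode_set nm B \<longleftrightarrow> (\<exists>x\<in>inner B. t = nm (I_name x))"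
  "Is_e_name t \<in> encode_set nm B \<longleftrightarrow> (\<exists>e\<in>edges B. t = nm (Edge e))"
  "Lc t k \<in> encode_set nm B \<longleftrightarrow> (\<exists>v\<in>nodes B. t = nm (Node v) \<and> k = ctrl B v)"
  "Lp t u \<in> encode_set nm B \<longleftrightarrow> (\<exists>p\<in>ports B. t = nm (Port p) \<and> u = nm (Node (fst p)))"
  by (auto simp: encode_set_def)

text \<open>Merging the blocks for nodes and sites exhibits the \<open>Prnt\<close> facts as the
  renamed graph of \<open>prnt B\<close> restricted to its domain.\<close>

lemma Prnt_in_encode_set_iff:
  "Prnt s d \<in> encode_set nm B \<longleftrightarrow>
     (\<exists>x\<in>prnt_dom B. s = place_src nm x \<and>
        d = place_dst nm (prnt B x))"
  by (auto simp: encode_set_def prnt_dom_def Plus_def bex_Un)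

lemma Link_in_encode_set_iff:
  "Link s d \<in> encode_set nm B \<longleftrightarrow>
     (\<exists>x\<in>link_dom B. s = link_src nm x \<and>
        d = link_dst nm (link B x))"
  by (auto simp: encode_set_def link_dom_def Plus_def bex_Un)

lemma den_nm:
  assumes "naming B nm den"
  shows "v \<in> nodes B \<Longrightarrow> den (nm (Node v)) = Node v"
    and "e \<in> edges B \<Longrightarrow> den (nm (Edge e)) = Edge e"
    and "p \<in> ports B \<Longrightarrow> den (nm (Port p)) = Port p"
    and "r < roots B \<Longrightarrow> den (nm (Root r)) = Root r"
    and "s < sites B \<Longrightarrow> den (nm (Site s)) = Site s"
    and "y \<in> outer B \<Longrightarrow> den (nm (O_name y)) = O_name y"
    and "x \<in> inner B \<Longrightarrow> den (nm (I_name x)) = I_name x"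
  using assms by (auto simp: naming_def elements_def)

text \<open>\<open>den\<close> is controlled only on names of elements of \<open>B\<close>; the
  membership assumption is the codomain condition that \<open>is_bigraph\<close> puts on
  \<open>prnt B\<close>.\<close>

lemma den_place_dst:
  assumes "naming B nm den" and "y \<in> nodes B <+> {..<roots B}"
  shows "den (dst_p_name (place_dst nm y)) = case_sum Node Root y"
  using assms(2) by (auto simp: den_nm[OF assms(1)])

lemma den_link_dst:
  assumes "naming B nm den" and "y \<in> edges B <+> outer B"
  shows "den (dst_l_name (link_dst nm y)) = case_sum Edge O_name y"
  using assms(2) by (auto simp: den_nm[OF assms(1)])

lemma den_place_src:
  assumes "naming B nm den" and "x \<in> prnt_dom B"
  shows "den (src_p_name (place_src nm x)) =
    case_sum Node Site x"
  using assms(2) by (auto simp: prnt_dom_def den_nm[OF assms(1)])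

lemma den_link_src:
  assumes "naming B nm den" and "x \<in> link_dom B"
  shows "den (src_l_name (link_src nm x)) =
    case_sum I_name Port x"
  using assms(2) by (auto simp: link_dom_def den_nm[OF assms(1)])

text \<open>Constructors of \<open>elem\<close> are injective and pairwise distinct, so each tagging
  of a sum is an embedding. This turns equality of denoted elements into equality of arguments and
  values of the maps.\<close>

lemma case_sum_elem_eq_iff:
  "case_sum Node Root y = case_sum Node Root y' \<longleftrightarrow> y = y'"
  "case_sum Node Site x = case_sum Node Site x' \<longleftrightarrow> x = x'"
  "case_sum Edge O_name z = case_sum Edge O_name z' \<longleftrightarrow> z = z'"
  "case_sum I_name Port w = case_sum I_name Port w' \<longleftrightarrow> w = w'"
  by (simp_all split: sum.splits)

lemma interp_encode_carriers:
  fixes B :: "('k, 'v, 'e, 'x) bigraph"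
  assumes "is_bigraph \<Sigma> B" and "naming B nm den"
  shows "sites (interp den (encode nm B)) = sites B"
    and "inner (interp den (encode nm B)) = inner B"
    and "roots (interp den (encode nm B)) = roots B"
    and "outer (interp den (encode nm B)) = outer B"
    and "nodes (interp den (encode nm B)) = nodes B"
    and "edges (interp den (encode nm B)) = edges B"
    and "ports (interp den (encode nm B)) = ports B"
proof -
  note simps = interp_def in_encode_iff[OF assms(1)] encode_set_simps
  note den = den_nm[OF assms(2)]
  \<comment> \<open>\<open>den_nm\<close> applies to the owner named in an \<open>Lp\<close> fact
    only once that owner is known to be a node of \<open>B\<close>.\<close>
  have fst_port: "fst p \<in> nodes B" if "p \<in> ports B" for p
    using assms(1) that by (auto simp: is_bigraph_def)
  \<comment> \<open>\<open>interp\<close> keeps only a cardinality, so the denoted sites must form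
    the whole initial segment.\<close>
  have "{s. \<exists>t. Is_site t \<in># encode nm B \<and> den t = Site s} = {..<sites B}"
    using den(5) by (fastforce simp: simps)
  then show "sites (interp den (encode nm B)) = sites B"
    by (simp add: interp_def)
  have "{r. \<exists>t. Is_root t \<in># encode nm B \<and> den t = Root r} = {..<roots B}"
    using den(4) by (fastforce simp: simps)
  then show "roots (interp den (encode nm B)) = roots B"
    by (simp add: interp_def)
  show "inner (interp den (encode nm B)) = inner B"
    using den(7) by (fastforce simp: simps)
  show "outer (interp den (encode nm B)) = outer B"
    using den(6) by (fastforce simp: simps)
  show "nodes (interp den (encode nm B)) = nodes B"
    using den(1) by (fastforce simp: simps)
  show "edges (interp den (encode nm B)) = edges B"
    using den(2) by (fastforce simp: simps)
  show "ports (interp den (encode nm B)) = ports B"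
  proof (rule set_eqI)
    fix p :: "'v \<times> nat"
    have "p \<in> ports (interp den (encode nm B)) \<longleftrightarrow>
      (\<exists>t a. Is_port t \<in> encode_set nm B \<and> Lp t a \<in> encode_set nm B \<and>
        den a = Node (fst p) \<and> den t = Port p)"
      by (cases p) (simp add: interp_def in_encode_iff[OF assms(1)])
    \<comment> \<open>The two facts are unfolded separately, so a priori they come from ports
      \<open>q\<close> and \<open>q'\<close> that merely share a name. Decoding forces
      \<open>q = p\<close>; for the converse both are taken to be \<open>p\<close>.\<close>
    also have "\<dots> \<longleftrightarrow> (\<exists>q\<in>ports B. \<exists>q'\<in>ports B. nm (Port q) = nm (Port q') \<and>
        den (nm (Node (fst q'))) = Node (fst p) \<and> den (nm (Port q)) = Port p)"
      unfolding encode_set_simps by blast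
    also have "\<dots> \<longleftrightarrow> (\<exists>q\<in>ports B. \<exists>q'\<in>ports B. nm (Port q) = nm (Port q') \<and> fst q' = fst p \<and> q = p)"
      by (intro bex_cong refl) (simp add: den fst_port)
    also have "\<dots> \<longleftrightarrow> p \<in> ports B"
      by blast
    finally show "p \<in> ports (interp den (encode nm B)) \<longleftrightarrow> p \<in> ports B" .
  qed
qed

text \<open>Decoding the name in an \<open>Lc\<close> fact recovers its node, so exactly one control
  fits \<open>v\<close> and the definite description in \<open>interp\<close> picks it out.\<close>

lemma ctrl_interp_encode:
  assumes "is_bigraph \<Sigma> B" and "naming B nm den" and "v \<in> nodes B"
  shows "ctrl (interp den (encode nm B)) v = ctrl B v"
proof -
  have "(\<exists>a. Lc a k \<in># encode nm B \<and> den a = Node v) \<longleftrightarrow> k = ctrl B v" for k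
    using assms(3) den_nm(1)[OF assms(2)]
    by (fastforce simp: in_encode_iff[OF assms(1)] encode_set_simps)
  then show ?thesis
    by (simp add: interp_def)
qed

text \<open>Each \<open>x\<close> in the domain is denoted by the source of exactly one fact, so
  \<open>THE\<close> has a unique candidate. Outside the domain there is no candidate, and the value
  is unspecified.\<close>

lemma prnt_interp_encode:
  fixes B :: "('k, 'v, 'e, 'x) bigraph"
  assumes "is_bigraph \<Sigma> B" and "naming B nm den" and "x \<in> prnt_dom B"
  shows "prnt (interp den (encode nm B)) x = prnt B x"
proof -
  have dst: "den (dst_p_name (place_dst nm (prnt B z))) = case_sum Node Root (prnt B z)"
    if "z \<in> prnt_dom B" for z
    by (rule den_place_dst[OF assms(2) funcset_mem[OF _ that]])
      (use assms(1) in \<open>simp add: is_bigraph_def\<close>)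
  have "(\<exists>s d. Prnt s d \<in># encode nm B \<and> den (src_p_name s) = case_sum Node Site x \<and>
      den (dst_p_name d) = case_sum Node Root y) \<longleftrightarrow> y = prnt B x" for y
  proof -
    have "(\<exists>s d. Prnt s d \<in># encode nm B \<and> den (src_p_name s) = case_sum Node Site x \<and>
        den (dst_p_name d) = case_sum Node Root y) \<longleftrightarrow>
      (\<exists>z\<in>prnt_dom B. den (src_p_name (place_src nm z)) = case_sum Node Site x \<and>
        den (dst_p_name (place_dst nm (prnt B z))) = case_sum Node Root y)"
      unfolding in_encode_iff[OF assms(1)] Prnt_in_encode_set_iff by blast
    \<comment> \<open>On the domain both source and destination decode to tagged elements;
      injectivity of the tags removes them.\<close>
    also have "\<dots> \<longleftrightarrow> (\<exists>z\<in>prnt_dom B. z = x \<and> prnt B z = y)"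
      by (rule bex_cong) (simp_all add: dst den_place_src[OF assms(2)] case_sum_elem_eq_iff)
    also have "\<dots> \<longleftrightarrow> y = prnt B x"
      using assms(3) by auto
    finally show ?thesis .
  qed
  then show ?thesis
    by (simp add: interp_def)
qed

text \<open>The argument for \<open>prnt\<close> carries over, with inner names and ports as
  sources.\<close>

lemma link_interp_encode:
  fixes B :: "('k, 'v, 'e, 'x) bigraph"
  assumes "is_bigraph \<Sigma> B" and "naming B nm den" and "x \<in> link_dom B"
  shows "link (interp den (encode nm B)) x = link B x"
proof -
  have dst: "den (dst_l_name (link_dst nm (link B z))) = case_sum Edge O_name (link B z)"
    if "z \<in> link_dom B" for z
    by (rule den_link_dst[OF assms(2) funcset_mem[OF _ that]])
      (use assms(1) in \<open>simp add: is_bigraph_def\<close>)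
  have "(\<exists>s d. Link s d \<in># encode nm B \<and> den (src_l_name s) = case_sum I_name Port x \<and>
      den (dst_l_name d) = case_sum Edge O_name y) \<longleftrightarrow> y = link B x" for y
  proof -
    have "(\<exists>s d. Link s d \<in># encode nm B \<and> den (src_l_name s) = case_sum I_name Port x \<and>
        den (dst_l_name d) = case_sum Edge O_name y) \<longleftrightarrow>
      (\<exists>z\<in>link_dom B. den (src_l_name (link_src nm z)) = case_sum I_name Port x \<and>
        den (dst_l_name (link_dst nm (link B z))) = case_sum Edge O_name y)"
      unfolding in_encode_iff[OF assms(1)] Link_in_encode_set_iff by blast
    also have "\<dots> \<longleftrightarrow> (\<exists>z\<in>link_dom B. z = x \<and> link B z = y)"
      by (rule bex_cong) (simp_all add: dst den_link_src[OF assms(2)] case_sum_elem_eq_iff)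
    also have "\<dots> \<longleftrightarrow> y = link B x"
      using assms(3) by auto
    finally show ?thesis .
  qed
  then show ?thesis
    by (simp add: interp_def)
qed

text \<open>The conditions in \<open>is_bigraph\<close> look at the maps only on their domains.
  Record equality would ask too much: the decoded maps may differ from those of \<open>B\<close>
  elsewhere, yet \<open>lean_equiv\<close> demands that both sides be bigraphs.\<close>

lemma is_bigraph_cong:
  assumes "is_bigraph \<Sigma> B"
    and carriers: "sites G = sites B" "inner G = inner B" "roots G = roots B" "outer G = outer B"
      "nodes G = nodes B" "edges G = edges B" "ports G = ports B"
    and ctrl: "\<And>v. v \<in> nodes B \<Longrightarrow> ctrl G v = ctrl B v"
    and prnt: "\<And>x. x \<in> prnt_dom B \<Longrightarrow> prnt G x = prnt B x"
    and link: "\<And>x. x \<in> link_dom B \<Longrightarrow> link G x = link B x"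
  shows "is_bigraph \<Sigma> G"
proof -
  have dom: "prnt_dom G = prnt_dom B" "link_dom G = link_dom B"
    by (simp_all add: prnt_dom_def link_dom_def carriers)
  \<comment> \<open>Acyclicity transfers because the parent relations on nodes coincide as
    sets.\<close>
  have parents: "{(v, w). v \<in> nodes B \<and> prnt G (Inl v) = Inl w} =
      {(v, w). v \<in> nodes B \<and> prnt B (Inl v) = Inl w}"
    using prnt[unfolded prnt_dom_def, OF InlI] by auto
  have sigma: "(SIGMA v : nodes B. {..<arity \<Sigma> (ctrl G v)}) =
      (SIGMA v : nodes B. {..<arity \<Sigma> (ctrl B v)})"
    by (rule Sigma_cong) (simp_all add: ctrl)
  show ?thesis
    using assms(1) unfolding is_bigraph_def carriers dom parents sigma
    by (simp add: Pi_iff ctrl prnt link)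
qed

theorem theorem2:
  fixes \<Sigma> :: "'k signature"
    and B :: "('k, 'v, 'e, 'x) bigraph"
    and nm :: "('v, 'e, 'x) elem \<Rightarrow> 't"
    and den :: "'t \<Rightarrow> ('v, 'e, 'x) elem"
  assumes "is_bigraph \<Sigma> B"
    and "naming B nm den"
  shows "lean_equiv \<Sigma> (interp den (encode nm B)) B"
proof -
  let ?G = "interp den (encode nm B)"
  note carriers = interp_encode_carriers[OF assms]
  note maps = ctrl_interp_encode[OF assms] prnt_interp_encode[OF assms] link_interp_encode[OF assms]
  have dom: "prnt_dom ?G = prnt_dom B" "link_dom ?G = link_dom B"
    by (simp_all add: prnt_dom_def link_dom_def carriers)
  have "is_bigraph \<Sigma> ?G"
    by (rule is_bigraph_cong[OF assms(1) carriers maps])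
  then show ?thesis
    unfolding lean_equiv_def carriers dom
    \<comment> \<open>\<open>exI[of _ id]\<close> serves for both bijections; the identity laws of
      \<open>map_sum\<close> and \<open>map_prod\<close> then reduce the commutation conditions to
      \<open>maps\<close>.\<close>
    by (intro conjI assms(1) refl exI[of _ id])
      (simp_all add: maps prod.map_id0 sum.map_id0)
qed

end
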